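(* Let $H''$ be the specific graph on 48 vertices defined in the context. If a subcubic graph $G$ contains $H''$ as a subgraph (not necessarily induced), then $G$ has no good coloring.
   Context: Graphs are finite, simple and undirected. A graph is subcubic if its maximum degree is at most 3. Good coloring: a good coloring of a graph is a 2-coloring of its vertices in colors blue and red (not required to be proper) such that (1) the subgraph induced by the blue vertices has maximum degree at most 1; (2) the subgraph induced by the red vertices has minimum degree at least 1 (every red vertex has a red neighbor); (3) the subgraph induced by the red vertices contains no path on 4 vertices (as a not necessarily induced subgraph). Graph $H$: the graph on vertices $v_0,\dots,v_7$ consisting of the 8-cycle $v_0v_1v_2v_3v_4v_5v_6v_7$ (edges $v_iv_{i+1}$, indices mod 8) with the two chords $v_2v_6$ and $v_3v_7$. Its vertices of degree 2 are $v_0,v_1,v_4,v_5$. Graph $H'$: take two disjoint copies of $H$, with vertices $v_0,\dots,v_7$ and $u_0,\dots,u_7$ (where $u_i$ corresponds to $v_i$), and add the two edges $v_4u_1$ and $v_5u_0$. (Adding $v_4u_0$ and $v_5u_1$ instead gives an isomorphic graph, by the automorphism of $H$ swapping $v_0\leftrightarrow v_1$, $v_2\leftrightarrow v_7$, $v_3\leftrightarrow v_6$, $v_4\leftrightarrow v_5$.) Its vertices of degree 2 are $v_0,v_1,u_4,u_5$. Graph $H''$: take three disjoint copies of $H'$; denote the vertices playing the roles of $v_0,v_1$ in the three copies by $v_0,v_1$, by $x_0,x_1$, and by $y_0,y_1$, respectively. Add the three edges $v_1x_0$, $x_1y_0$, $y_1v_0$, so that $v_0v_1x_0x_1y_0y_1$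 is a 6-cycle meeting all three copies of $H'$. *)

theory Defs
  imports "Graph_Theory.Graph_Theory"
begin

text \<open>
  Finite simple undirected graphs are the library's \<^locale>\<open>pair_graph\<close>: finite, loop-free digraphs
  without parallel arcs whose arc relation is symmetric, so an undirected edge is a pair of opposite
  arcs and \<^const>\<open>out_degree\<close> counts the neighbours of a vertex.
\<close>

definition max_degree_at_most :: "nat \<Rightarrow> ('a, 'b) pre_digraph \<Rightarrow> bool" where
  "max_degree_at_most k G \<longleftrightarrow> (\<forall>v \<in> verts G. out_degree G v \<le> k)"

definition min_degree_at_least :: "nat \<Rightarrow> ('a, 'b) pre_digraph \<Rightarrow> bool" where
  "min_degree_at_least k G \<longleftrightarrow> (\<forall>v \<in> verts G. k \<le> out_degree G v)"

definition subcubic :: "('a, 'b) pre_digraph \<Rightarrow> bool" where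
  "subcubic G \<longleftrightarrow> max_degree_at_most 3 G"

text \<open>A path on \<open>n\<close> vertices is a list of \<open>n\<close> distinct, successively adjacent vertices.\<close>

definition has_path_on :: "nat \<Rightarrow> ('a, 'b) pre_digraph \<Rightarrow> bool" where
  "has_path_on n G \<longleftrightarrow> (\<exists>p. vpath p G \<and> length p = n)"

datatype color = Blue | Red

definition color_class :: "('a, 'b) pre_digraph \<Rightarrow> ('a \<Rightarrow> color) \<Rightarrow> color \<Rightarrow> ('a, 'b) pre_digraph" where
  "color_class G c x = G \<restriction> {v \<in> verts G. c v = x}"

definition good_coloring :: "('a, 'b) pre_digraph \<Rightarrow> ('a \<Rightarrow> color) \<Rightarrow> bool" where
  "good_coloring G c \<longleftrightarrow>
     max_degree_at_most 1 (color_class G c Blue) \<and>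
     min_degree_at_least 1 (color_class G c Red) \<and>
     \<not> has_path_on 4 (color_class G c Red)"

text \<open>\<open>G\<close> contains \<open>K\<close> as a (not necessarily induced) subgraph.\<close>

definition contains_subgraph :: "'a pair_pre_digraph \<Rightarrow> 'b pair_pre_digraph \<Rightarrow> bool" where
  "contains_subgraph G K \<longleftrightarrow>
     (\<exists>S :: 'a pair_pre_digraph.
        subgraph (with_proj S) (with_proj G) \<and> digraph_iso (with_proj K) (with_proj S))"

text \<open>The undirected graph with vertex set \<open>V\<close> and an edge \<open>uv\<close> for every pair \<open>(u, v)\<close> in \<open>E\<close>.\<close>

definition undirected :: "'a set \<Rightarrow> ('a \<times> 'a) set \<Rightarrow> 'a pair_pre_digraph" where
  "undirected V E = mk_symmetric (with_proj \<lparr>pverts = V, parcs = E\<rparr>)"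

text \<open>
  The disjoint union of \<open>k\<close> copies of \<open>G\<close>, where \<open>(j, v)\<close> is the vertex \<open>v\<close> of the \<open>j\<close>-th copy,
  together with the additional edges \<open>E\<close>.
\<close>

definition linked_copies ::
  "nat \<Rightarrow> 'a pair_pre_digraph \<Rightarrow> ((nat \<times> 'a) \<times> (nat \<times> 'a)) set \<Rightarrow> (nat \<times> 'a) pair_pre_digraph" where
  "linked_copies k G E =
     undirected ({..<k} \<times> pverts G)
       ({((j, u), (j, v)) | j u v. j < k \<and> (u, v) \<in> parcs G} \<union> E)"

text \<open>The number \<open>i\<close> stands for the vertex \<open>v\<^sub>i\<close>.\<close>

definition graph_H :: "nat pair_pre_digraph" where
  "graph_H = undirected {..<8} ({(i, (i + 1) mod 8) | i. i < 8} \<union> {(2, 6), (3, 7)})"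

text \<open>Here \<open>v\<^sub>i\<close> is \<open>(0, i)\<close> and \<open>u\<^sub>i\<close> is \<open>(1, i)\<close>.\<close>

definition graph_H' :: "(nat \<times> nat) pair_pre_digraph" where
  "graph_H' = linked_copies 2 graph_H {((0, 4), (1, 1)), ((0, 5), (1, 0))}"

text \<open>
  The vertices \<open>v\<^sub>i\<close>, \<open>x\<^sub>i\<close> and \<open>y\<^sub>i\<close> for \<open>i \<in> {0, 1}\<close> are \<open>(0, 0, i)\<close>, \<open>(1, 0, i)\<close> and
  \<open>(2, 0, i)\<close>.
\<close>

definition graph_H'' :: "(nat \<times> nat \<times> nat) pair_pre_digraph" where
  "graph_H'' = linked_copies 3 graph_H'
     {((0, 0, 1), (1, 0, 0)), ((1, 0, 1), (2, 0, 0)), ((2, 0, 1), (0, 0, 0))}"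

lemma contains_subgraph_iff:
  assumes "pair_graph G" "pair_graph K"
  shows "contains_subgraph G K \<longleftrightarrow>
    (\<exists>f. inj_on f (pverts K) \<and> f ` pverts K \<subseteq> pverts G \<and>
       (\<forall>(u, v) \<in> parcs K. (f u, f v) \<in> parcs G))" (is "?L \<longleftrightarrow> ?R")
proof
  assume ?L
  then obtain S :: "'a pair_pre_digraph" and h where S: "subgraph (with_proj S) (with_proj G)"
    and h: "pre_digraph.digraph_isomorphism (with_proj K) h" "with_proj S = app_iso h (with_proj K)"
    unfolding contains_subgraph_def digraph_iso_def by blast
  let ?f = "iso_verts h"
  from h(2) have eq: "pverts S = ?f ` pverts K" "parcs S = iso_arcs h ` parcs K"
      "iso_tail h = fst" "iso_head h = snd"
    by (simp_all add: with_proj_def app_iso_def)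
  from S have sub: "pverts S \<subseteq> pverts G" "parcs S \<subseteq> parcs G"
    by (auto simp: subgraph_def)
  have "(?f u, ?f v) \<in> parcs G" if "(u, v) \<in> parcs K" for u v
  proof -
    have "?f u = fst (iso_arcs h (u, v))" "?f v = snd (iso_arcs h (u, v))"
      using h(1) that eq by (auto simp: pre_digraph.digraph_isomorphism_def)
    then have "(?f u, ?f v) = iso_arcs h (u, v)" by simp
    with that eq sub show ?thesis by auto
  qed
  moreover have "inj_on ?f (pverts K)"
    using h(1) by (simp add: pre_digraph.digraph_isomorphism_def)
  ultimately show ?R using eq sub by blast
next
  assume ?R
  then obtain f where f: "inj_on f (pverts K)" "f ` pverts K \<subseteq> pverts G"
    "\<And>u v. (u, v) \<in> parcs K \<Longrightarrow> (f u, f v) \<in> parcs G" by (elim exE conjE) (rule that, auto)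
  interpret G: pair_graph G by fact
  interpret K: pair_graph K by fact
  define S where "S = \<lparr>pverts = f ` pverts K, parcs = map_prod f f ` parcs K\<rparr>"
  define h where "h = \<lparr>iso_verts = f, iso_arcs = map_prod f f, iso_head = snd, iso_tail = fst\<rparr>"
  have "wf_digraph (with_proj S)"
    by unfold_locales (auto simp: S_def dest: K.in_arcsD1 K.in_arcsD2)
  then have "subgraph (with_proj S) (with_proj G)"
    using f G.wf_digraph by (auto simp: subgraph_def compatible_def S_def)
  moreover have "inj_on (map_prod f f) (parcs K)"
    by (rule inj_on_subset[OF map_prod_inj_on[OF f(1) f(1)]]) (auto dest: K.in_arcsD1 K.in_arcsD2)
  then have "pre_digraph.digraph_isomorphism (with_proj K) h"
    using f(1) K.wf_digraph by (auto simp: pre_digraph.digraph_isomorphism_def h_def)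
  moreover have "with_proj S = app_iso h (with_proj K)"
    by (simp add: with_proj_def app_iso_def S_def h_def)
  ultimately show ?L unfolding contains_subgraph_def digraph_iso_def by blast
qed

lemma pverts_undirected [simp]: "pverts (undirected V E) = V"
  by (simp add: undirected_def)

lemma parcs_undirected [simp]: "parcs (undirected V E) = E \<union> E\<inverse>"
  by (auto simp: undirected_def parcs_mk_symmetric)

lemma pair_graph_undirected:
  assumes "finite V" "E \<subseteq> V \<times> V" "\<And>v. (v, v) \<notin> E"
  shows "pair_graph (undirected V E)"
proof -
  have "finite E"
    using assms(1,2) by (meson finite_SigmaI finite_subset)
  moreover have "symmetric (with_proj (undirected V E))"
    unfolding undirected_def by (rule symmetric_mk_symmetric)
  ultimately show ?thesis
    using assms by unfold_locales auto
qed

lemma pair_graph_linked_copies: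
  assumes "pair_graph G" "E \<subseteq> ({..<k} \<times> pverts G) \<times> ({..<k} \<times> pverts G)" "\<And>v. (v, v) \<notin> E"
  shows "pair_graph (linked_copies k G E)"
proof -
  interpret pair_graph G by fact
  show ?thesis
    unfolding linked_copies_def
  proof (rule pair_graph_undirected)
    show "finite ({..<k} \<times> pverts G)"
      by simp
    show "{((j, u), (j, v)) |j u v. j < k \<and> (u, v) \<in> parcs G} \<union> E
        \<subseteq> ({..<k} \<times> pverts G) \<times> ({..<k} \<times> pverts G)"
      using assms(2) by (auto dest: in_arcsD1 in_arcsD2)
    show "(v, v) \<notin> {((j, u), (j, v)) |j u v. j < k \<and> (u, v) \<in> parcs G} \<union> E" for v
      using assms(3) pair_no_loops by fastforce
  qed
qed

lemma pverts_graph_H: "pverts graph_H = {..<8}"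
  by (simp add: graph_H_def)

lemma pverts_graph_H': "pverts graph_H' = {..<2} \<times> {..<8}"
  by (simp add: graph_H'_def linked_copies_def pverts_graph_H)

lemma pverts_graph_H'': "pverts graph_H'' = {..<3} \<times> {..<2} \<times> {..<8}"
  by (simp add: graph_H''_def linked_copies_def pverts_graph_H')

lemma card_pverts_graph_H'': "card (pverts graph_H'') = 48"
  by (simp add: pverts_graph_H'' card_cartesian_product)

lemma pair_graph_H: "pair_graph graph_H"
  unfolding graph_H_def
proof (rule pair_graph_undirected)
  show "(v, v) \<notin> {(i, (i + 1) mod 8) |i. i < 8} \<union> {(2, 6), (3, 7)}" for v :: nat
    by (auto simp: mod_Suc split: if_splits)
qed auto

lemma pair_graph_H': "pair_graph graph_H'"
  unfolding graph_H'_def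
  by (rule pair_graph_linked_copies) (auto simp: pair_graph_H pverts_graph_H)

lemma pair_graph_H'': "pair_graph graph_H''"
  unfolding graph_H''_def
  by (rule pair_graph_linked_copies) (auto simp: pair_graph_H' pverts_graph_H')

end

theory Submission
  imports Defs
begin

text \<open>
  A good coloring obeys three local rules: a blue vertex has at most one blue neighbour, a red
  vertex whose three neighbours are known has a red one among them, and no path on four vertices
  is red. In a copy of \<open>H\<close> with vertices \<open>v\<^sub>0, \<dots>, v\<^sub>7\<close> these rules have two consequences.

  \<^item> The vertices \<open>v\<^sub>0\<close> and \<open>v\<^sub>1\<close> are not both red (\<open>H_copy_not_both_red\<close>).
  \<^item> If \<open>v\<^sub>1\<close> is red and its neighbour outside the copy is blue, then the other end of the copy,
    \<open>v\<^sub>4v\<^sub>5\<close>, is entirely blue (\<open>H_copy_far_end_blue\<close>); by the reflection of \<open>H\<close> that swaps \<open>v\<^sub>0\<close>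
    and \<open>v\<^sub>1\<close>, the same holds for \<open>v\<^sub>0\<close>.

  The second copy of \<open>H\<close> in \<open>H'\<close> serves to exclude that blue end: if \<open>v\<^sub>4\<close> and \<open>v\<^sub>5\<close> were both blue,
  their neighbours \<open>u\<^sub>1\<close> and \<open>u\<^sub>0\<close> would both be red, which the first fact forbids. So in a copy of
  \<open>H'\<close> a red vertex among \<open>v\<^sub>0, v\<^sub>1\<close> has a red outer neighbour, \<open>v\<^sub>0\<close> and \<open>v\<^sub>1\<close> are not both red, and
  if both are blue then both outer neighbours are red (\<open>linked_H_copies\<close>).

  On the 6-cycle \<open>v\<^sub>0v\<^sub>1x\<^sub>0x\<^sub>1y\<^sub>0y\<^sub>1\<close> of \<open>H''\<close> the edges \<open>v\<^sub>1x\<^sub>0\<close>, \<open>x\<^sub>1y\<^sub>0\<close>, \<open>y\<^sub>1v\<^sub>0\<close> are therefore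
  monochromatic. Two blue vertices in one pair, say \<open>v\<^sub>0, v\<^sub>1\<close>, would give a red \<open>x\<^sub>0\<close> with the blue
  outer neighbour \<open>v\<^sub>1\<close>; hence each of the three pairs has exactly one red vertex. Colors then
  alternate across the edges \<open>v\<^sub>0v\<^sub>1\<close>, \<open>x\<^sub>0x\<^sub>1\<close>, \<open>y\<^sub>0y\<^sub>1\<close> and stay the same across the other three, so
  going once around the cycle changes the color three times, which is impossible.
\<close>

section \<open>Good colorings as local rules\<close>

lemma out_degree_color_class:
  assumes "c v = x"
  shows "out_degree (color_class (with_proj G) c x) v =
    card {w. (v, w) \<in> parcs G \<and> v \<in> pverts G \<and> w \<in> pverts G \<and> c w = x}"
proof -
  have "out_arcs (color_class (with_proj G) c x) v =
      Pair v ` {w. (v, w) \<in> parcs G \<and> v \<in> pverts G \<and> w \<in> pverts G \<and> c w = x}"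
    using assms by (auto simp: color_class_def out_arcs_def)
  then show ?thesis
    by (simp add: out_degree_def card_image inj_on_def)
qed

locale good_colored_subcubic = pair_graph G for G :: "'a pair_pre_digraph" +
  fixes c :: "'a \<Rightarrow> color"
  assumes subcubic: "subcubic (with_proj G)"
    and good: "good_coloring (with_proj G) c"
begin

abbreviation adj :: "'a \<Rightarrow> 'a \<Rightarrow> bool" where
  "adj u v \<equiv> (u, v) \<in> parcs G"

abbreviation red :: "'a \<Rightarrow> bool" where
  "red v \<equiv> c v = Red"

lemma not_red_iff: "\<not> red v \<longleftrightarrow> c v = Blue"
  by (cases "c v") auto

lemma adj_sym: "adj u v \<longleftrightarrow> adj v u"
  using arcs_symmetric by blast

lemma finite_neighbours: "finite {w. adj v w \<and> P w}"
  by (rule finite_subset[of _ "pverts G"]) (auto dest: in_arcsD2)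

lemma blue_neighbours:
  assumes "\<not> red v" "adj v a" "adj v b" "a \<noteq> b"
  shows "red a \<or> red b"
proof (rule ccontr)
  assume "\<not> (red a \<or> red b)"
  with assms have "{a, b} \<subseteq> {w. adj v w \<and> v \<in> pverts G \<and> w \<in> pverts G \<and> c w = Blue}"
    by (auto simp: not_red_iff dest: in_arcsD1 in_arcsD2)
  from card_mono[OF finite_neighbours this] \<open>a \<noteq> b\<close>
  have "2 \<le> out_degree (color_class (with_proj G) c Blue) v"
    using assms(1) by (simp add: out_degree_color_class not_red_iff)
  moreover have "v \<in> verts (color_class (with_proj G) c Blue)"
    using assms by (auto simp: color_class_def not_red_iff dest: in_arcsD1)
  ultimately show False
    using good by (fastforce simp: good_coloring_def max_degree_at_most_def)
qed

text \<open>
  Some neighbour of a red vertex is red; since \<open>G\<close> is subcubic, it is one of any three distinct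
  neighbours.
\<close>

lemma red_neighbours:
  assumes "red v" "adj v x" "adj v y" "adj v z" "distinct [x, y, z]"
  shows "red x \<or> red y \<or> red z"
proof -
  have v: "v \<in> pverts G"
    using assms(2) by (rule in_arcsD1)
  have "v \<in> verts (color_class (with_proj G) c Red)"
    using assms(1) v by (simp add: color_class_def)
  then have "1 \<le> out_degree (color_class (with_proj G) c Red) v"
    using good by (simp add: good_coloring_def min_degree_at_least_def)
  then have "1 \<le> card {w. adj v w \<and> v \<in> pverts G \<and> w \<in> pverts G \<and> red w}"
    using assms(1) by (simp add: out_degree_color_class)
  then have "{w. adj v w \<and> v \<in> pverts G \<and> w \<in> pverts G \<and> red w} \<noteq> {}"
    by (metis card.empty not_one_le_zero)
  then obtain w where w: "adj v w" "red w"
    by blast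
  have "out_arcs (with_proj G) v = Pair v ` {u. adj v u}"
    by (auto simp: out_arcs_def)
  then have "out_degree (with_proj G) v = card {u. adj v u}"
    by (simp add: out_degree_def card_image inj_on_def)
  then have "card {u. adj v u} \<le> 3"
    using subcubic v by (fastforce simp: subcubic_def max_degree_at_most_def)
  moreover have "finite {u. adj v u}"
    using finite_neighbours[of v "\<lambda>_. True"] by simp
  ultimately have "{x, y, z} = {u. adj v u}"
    using assms by (intro card_seteq) auto
  then show ?thesis
    using w by auto
qed

lemma no_red_path:
  assumes "adj x y" "adj y z" "adj z w" "distinct [x, y, z, w]"
  shows "\<not> (red x \<and> red y \<and> red z \<and> red w)"
proof
  assume "red x \<and> red y \<and> red z \<and> red w"
  with assms have "vpath [x, y, z, w] (color_class (with_proj G) c Red)"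
    by (auto simp: vpath_def vwalk_def color_class_def arcs_ends_def arc_to_ends_def
        image_iff dest: in_arcsD1 in_arcsD2)
  then have "has_path_on 4 (color_class (with_proj G) c Red)"
    unfolding has_path_on_def by (intro exI[of _ "[x, y, z, w]"]) simp
  with good show False
    by (simp add: good_coloring_def)
qed

section \<open>Copies of \<open>H\<close>\<close>

definition H_copy :: "(nat \<Rightarrow> 'a) \<Rightarrow> bool" where
  "H_copy v \<longleftrightarrow> inj_on v {..<8} \<and> (\<forall>(i, j) \<in> parcs graph_H. adj (v i) (v j))"

lemma H_copy_neq: "H_copy v \<Longrightarrow> i < 8 \<Longrightarrow> j < 8 \<Longrightarrow> v i = v j \<longleftrightarrow> i = j"
  by (auto simp: H_copy_def inj_on_eq_iff)

lemma H_copyD: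
  assumes "H_copy v"
  shows "adj (v 0) (v 1)" "adj (v 1) (v 2)" "adj (v 2) (v 3)" "adj (v 3) (v 4)"
    "adj (v 4) (v 5)" "adj (v 5) (v 6)" "adj (v 6) (v 7)" "adj (v 7) (v 0)"
    "adj (v 2) (v 6)" "adj (v 3) (v 7)"
proof -
  have step: "adj (v i) (v ((i + 1) mod 8))" if "i < 8" for i
    using assms that by (auto simp: H_copy_def graph_H_def)
  show "adj (v 0) (v 1)" "adj (v 1) (v 2)" "adj (v 2) (v 3)" "adj (v 3) (v 4)"
    "adj (v 4) (v 5)" "adj (v 5) (v 6)" "adj (v 6) (v 7)" "adj (v 7) (v 0)"
    using step[of 0] step[of 1] step[of 2] step[of 3] step[of 4] step[of 5] step[of 6] step[of 7]
    by (simp_all del: add_Suc_right One_nat_def)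
  show "adj (v 2) (v 6)" "adj (v 3) (v 7)"
    using assms by (auto simp: H_copy_def graph_H_def)
qed

text \<open>
  The automorphism \<open>i \<mapsto> 1 - i\<close> (modulo 8) of \<open>H\<close>, written with 9 in place of 1 to avoid
  truncated subtraction. It halves the case distinctions below.
\<close>

lemma H_copy_reflect:
  assumes "H_copy v"
  shows "H_copy (\<lambda>i. v ((9 - i) mod 8))"
proof -
  have less8: "i < 8 \<longleftrightarrow> i \<in> {0, 1, 2, 3, 4, 5, 6, 7}" for i :: nat
    by auto
  have "inj_on (\<lambda>i. v ((9 - i) mod 8)) {..<8}"
    by (auto simp: inj_on_def less8 H_copy_neq[OF assms])
  moreover have "adj (v ((9 - i) mod 8)) (v ((9 - j) mod 8))" if "(i, j) \<in> parcs graph_H" for i j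
    using that H_copyD[OF assms] H_copyD[OF assms, THEN adj_sym[THEN iffD1]]
    by (auto simp: graph_H_def less8)
  ultimately show ?thesis
    by (auto simp: H_copy_def)
qed


text \<open>
  A red \<open>v\<^sub>2\<close> would complete a red path \<open>v\<^sub>0v\<^sub>1v\<^sub>2\<close> and so force \<open>v\<^sub>7\<close> and two of its neighbours,
  \<open>v\<^sub>3\<close> and \<open>v\<^sub>6\<close>, to be blue.
\<close>

lemma H_copy_red_pair_next_blue:
  assumes "H_copy v" "red (v 0)" "red (v 1)"
  shows "\<not> red (v 2)"
proof
  note E = H_copyD[OF assms(1)] H_copyD[OF assms(1), THEN adj_sym[THEN iffD1]]
  note D = H_copy_neq[OF assms(1)]
  assume "red (v 2)"
  then have "\<not> red (v 7)" "\<not> red (v 3)" "\<not> red (v 6)"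
    using assms no_red_path[of "v 7" "v 0" "v 1" "v 2"] no_red_path[of "v 0" "v 1" "v 2" "v 3"]
      no_red_path[of "v 0" "v 1" "v 2" "v 6"] E D by auto
  then show False
    using blue_neighbours[of "v 7" "v 3" "v 6"] E D by auto
qed

text \<open>
  If \<open>v\<^sub>0\<close> and \<open>v\<^sub>1\<close> are red, then \<open>v\<^sub>2\<close> and \<open>v\<^sub>7\<close> are blue. Since \<open>v\<^sub>3\<close> and \<open>v\<^sub>6\<close> are adjacent to both
  of them, they are red, each needs a red neighbour, and only \<open>v\<^sub>4\<close> and \<open>v\<^sub>5\<close> are left; this yields
  the red path \<open>v\<^sub>3v\<^sub>4v\<^sub>5v\<^sub>6\<close>.
\<close>

lemma H_copy_not_both_red:
  assumes "H_copy v"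
  shows "\<not> (red (v 0) \<and> red (v 1))"
proof
  note E = H_copyD[OF assms] H_copyD[OF assms, THEN adj_sym[THEN iffD1]]
  note D = H_copy_neq[OF assms]
  assume r: "red (v 0) \<and> red (v 1)"
  then have b: "\<not> red (v 2)" "\<not> red (v 7)"
    using H_copy_red_pair_next_blue[OF assms]
      H_copy_red_pair_next_blue[OF H_copy_reflect[OF assms]] by auto
  then have "red (v 3)" "red (v 6)"
    using blue_neighbours[of "v 3" "v 2" "v 7"] blue_neighbours[of "v 6" "v 2" "v 7"] E D by auto
  moreover from this b have "red (v 4)" "red (v 5)"
    using red_neighbours[of "v 3" "v 2" "v 4" "v 7"] red_neighbours[of "v 6" "v 5" "v 7" "v 2"] E D
    by auto
  ultimately show False
    using no_red_path[of "v 3" "v 4" "v 5" "v 6"] E D by auto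
qed

text \<open>
  Here \<open>v\<^sub>1\<close> can only have \<open>v\<^sub>2\<close> as its red neighbour. Inspecting \<open>v\<^sub>7\<close>, whose neighbour \<open>v\<^sub>0\<close> is
  blue, shows that \<open>v\<^sub>3\<close> and \<open>v\<^sub>6\<close> are red as well. Then \<open>v\<^sub>2\<close> is the centre of a red star with leaves
  \<open>v\<^sub>1, v\<^sub>3, v\<^sub>6\<close>, and a red \<open>v\<^sub>4\<close> or \<open>v\<^sub>5\<close>, being adjacent to a leaf, would create a red path on four
  vertices.
\<close>

lemma H_copy_far_end_blue:
  assumes "H_copy v" "adj (v 1) e" "e \<noteq> v 0" "e \<noteq> v 2" "red (v 1)" "\<not> red e"
  shows "\<not> red (v 4) \<and> \<not> red (v 5)"
proof -
  note E = H_copyD[OF assms(1)] H_copyD[OF assms(1), THEN adj_sym[THEN iffD1]]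
  note D = H_copy_neq[OF assms(1)]
  have b0: "\<not> red (v 0)"
    using H_copy_not_both_red assms by blast
  then have r2: "red (v 2)"
    using red_neighbours[of "v 1" "v 0" "v 2" e] E D assms by auto
  have b7: "\<not> red (v 7)" if "red (v 3) \<or> red (v 6)"
    using that r2 assms no_red_path[of "v 1" "v 2" "v 3" "v 7"]
      no_red_path[of "v 1" "v 2" "v 6" "v 7"] E D by auto
  have "red (v 3) \<or> red (v 6)"
  proof (rule ccontr)
    assume b: "\<not> (red (v 3) \<or> red (v 6))"
    then have "red (v 7)"
      using b0 blue_neighbours[of "v 7" "v 0" "v 3"] E D by auto
    then show False
      using b b0 red_neighbours[of "v 7" "v 6" "v 0" "v 3"] E D by auto
  qed
  then have "red (v 3)" "red (v 6)"
    using b0 b7 blue_neighbours[of "v 7" "v 0" "v 3"] blue_neighbours[of "v 7" "v 0" "v 6"] E D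
    by auto
  then show ?thesis
    using r2 assms no_red_path[of "v 1" "v 2" "v 3" "v 4"] no_red_path[of "v 1" "v 2" "v 6" "v 5"]
      E D by auto
qed

section \<open>Copies of \<open>H'\<close> and \<open>H''\<close>\<close>

text \<open>
  What a copy of \<open>H'\<close> imposes on the rest of the graph: the vertices \<open>e\<^sub>0\<close> and \<open>e\<^sub>1\<close> are the outer
  neighbours of \<open>v\<^sub>0\<close> and \<open>v\<^sub>1\<close>.
\<close>

lemma linked_H_copies:
  assumes v: "H_copy v" and u: "H_copy u"
    and link: "adj (v 4) (u 1)" "adj (v 5) (u 0)"
    and disjoint: "v ` {..<8} \<inter> u ` {..<8} = {}"
    and e: "adj (v 0) e0" "adj (v 1) e1" "e0 \<notin> v ` {..<8}" "e1 \<notin> v ` {..<8}"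
  shows "\<not> (red (v 0) \<and> red (v 1))" "red (v 0) \<Longrightarrow> red e0" "red (v 1) \<Longrightarrow> red e1"
    "\<not> red (v 0) \<Longrightarrow> \<not> red (v 1) \<Longrightarrow> red e0 \<and> red e1"
proof -
  have neq: "v i \<noteq> u j" if "i < 8" "j < 8" for i j
    using that disjoint by blast
  have neq_e: "e0 \<noteq> v i" "e1 \<noteq> v i" if "i < 8" for i
    using that e by blast+
  note E = H_copyD[OF v] H_copyD[OF v, THEN adj_sym[THEN iffD1]]
  have "red (v 4) \<or> red (v 5)"
  proof (rule ccontr)
    assume b: "\<not> (red (v 4) \<or> red (v 5))"
    then have "red (u 1)" "red (u 0)"
      using blue_neighbours[of "v 4" "v 5" "u 1"] blue_neighbours[of "v 5" "v 4" "u 0"] E link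
        neq[of 5 1] neq[of 4 0] by auto
    with H_copy_not_both_red[OF u] show False
      by blast
  qed
  then show "red (v 1) \<Longrightarrow> red e1" "red (v 0) \<Longrightarrow> red e0"
    using H_copy_far_end_blue[OF v, of e1] H_copy_far_end_blue[OF H_copy_reflect[OF v], of e0] e neq_e
    by auto
  show "\<not> (red (v 0) \<and> red (v 1))"
    by (rule H_copy_not_both_red[OF v])
  show "red e0 \<and> red e1" if "\<not> red (v 0)" "\<not> red (v 1)"
    using that e E neq_e(1)[of 1] neq_e(2)[of 0] blue_neighbours[of "v 0" "v 1" e0] blue_neighbours[of "v 1" "v 0" e1] by auto
qed

lemma no_H''_copy:
  assumes inj: "inj_on f (pverts graph_H'')"
    and hom: "\<And>p q. (p, q) \<in> parcs graph_H'' \<Longrightarrow> adj (f p) (f q)"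
  shows False
proof -
  let ?v = "\<lambda>j k i. f (j, k, i)"
  have eq: "?v j k i = ?v j' k' i' \<longleftrightarrow> j = j' \<and> k = k' \<and> i = i'"
    if "j < 3" "k < 2" "i < 8" "j' < 3" "k' < 2" "i' < 8" for j k i j' k' i'
    using that inj by (auto simp: inj_on_eq_iff pverts_graph_H'')
  have H: "H_copy (?v j k)" if "j < 3" "k < 2" for j k
    using that eq by (auto simp: H_copy_def inj_on_def intro!: hom)
      (auto simp: graph_H''_def graph_H'_def linked_copies_def)
  have link: "adj (?v j 0 4) (?v j 1 1)" "adj (?v j 0 5) (?v j 1 0)" if "j < 3" for j
    using that by (auto intro!: hom simp: graph_H''_def graph_H'_def linked_copies_def)
  have cycle: "adj (?v 0 0 1) (?v 1 0 0)" "adj (?v 1 0 1) (?v 2 0 0)" "adj (?v 2 0 1) (?v 0 0 0)"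
    "adj (?v 1 0 0) (?v 0 0 1)" "adj (?v 2 0 0) (?v 1 0 1)" "adj (?v 0 0 0) (?v 2 0 1)"
    by (auto intro!: hom simp: graph_H''_def linked_copies_def)
  have disj: "?v j 0 ` {..<8} \<inter> ?v j 1 ` {..<8} = {}" if "j < 3" for j
    using that by (auto simp: eq)
  have out: "?v j' 0 i \<notin> ?v j 0 ` {..<8}" if "j \<noteq> j'" "j < 3" "j' < 3" "i < 8" for j j' i
    using that by (auto simp: eq)
  have copy: "\<not> (red (?v j 0 0) \<and> red (?v j 0 1))"
    "red (?v j 0 0) \<Longrightarrow> red (?v a 0 1)" "red (?v j 0 1) \<Longrightarrow> red (?v b 0 0)"
    "\<not> red (?v j 0 0) \<Longrightarrow> \<not> red (?v j 0 1) \<Longrightarrow> red (?v a 0 1) \<and> red (?v b 0 0)"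
    if j: "j < 3" and ab: "a < 3" "b < 3" "j \<noteq> a" "j \<noteq> b"
      and adj: "adj (?v j 0 0) (?v a 0 1)" "adj (?v j 0 1) (?v b 0 0)" for j a b
  proof -
    have "H_copy (?v j 0)" "H_copy (?v j 1)" "?v a 0 1 \<notin> ?v j 0 ` {..<8}"
      "?v b 0 0 \<notin> ?v j 0 ` {..<8}"
      using H[OF j] out[OF _ j] ab by simp_all
    note L = linked_H_copies[OF this(1,2) link[OF j] disj[OF j] adj this(3,4)]
    show "\<not> (red (?v j 0 0) \<and> red (?v j 0 1))"
      "red (?v j 0 0) \<Longrightarrow> red (?v a 0 1)" "red (?v j 0 1) \<Longrightarrow> red (?v b 0 0)"
      "\<not> red (?v j 0 0) \<Longrightarrow> \<not> red (?v j 0 1) \<Longrightarrow> red (?v a 0 1) \<and> red (?v b 0 0)"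
      by (rule L(1), rule L(2), assumption, rule L(3), assumption, rule L(4))
  qed
  \<comment> \<open>the linking edges of the 6-cycle preserve colors and each copy's own edge switches them\<close>
  show False
    using copy[OF _ _ _ _ _ cycle(6,1), simplified] copy[OF _ _ _ _ _ cycle(4,2), simplified]
      copy[OF _ _ _ _ _ cycle(5,3), simplified] by blast
qed

end

theorem theorem7:
  fixes G :: "'a pair_pre_digraph"
  assumes "pair_graph G"
    and "subcubic (with_proj G)"
    and "contains_subgraph G graph_H''"
  shows "\<not> (\<exists>c. good_coloring (with_proj G) c)"
proof
  assume "\<exists>c. good_coloring (with_proj G) c"
  then obtain c where "good_coloring (with_proj G) c" ..
  then interpret good_colored_subcubic G c
    using assms by (intro good_colored_subcubic.intro good_colored_subcubic_axioms.intro)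
  obtain f where f: "inj_on f (pverts graph_H'')"
    "\<forall>(p, q) \<in> parcs graph_H''. adj (f p) (f q)"
    using assms(3) unfolding contains_subgraph_iff[OF assms(1) pair_graph_H''] by blast
  show False
    by (rule no_H''_copy[OF f(1)]) (use f(2) in blast)
qed

end
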